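(* Let $f:[0,1]^n\to\mathbb{R}$, $f(\boldsymbol{x})=\sum_{ij\in E}a_{ij}x_ix_j$, be a bilinear function, where $E$ is a set of two-element subsets of $[n]$ and $a_{ij}\in\mathbb{R}\setminus\{0\}$. Then for every $\boldsymbol{x}\in[0,1]^n$, $$\operatorname{vex}[f](\boldsymbol{x})=\min\left\{\sum_{ij\in E}a_{ij}\,\mu(X_i\cap X_j):\ X_i\in\mathcal{L},\ \mu(X_i)=x_i\text{ for all }i\in[n]\right\},$$ $$\operatorname{cav}[f](\boldsymbol{x})=\max\left\{\sum_{ij\in E}a_{ij}\,\mu(X_i\cap X_j):\ X_i\in\mathcal{L},\ \mu(X_i)=x_i\text{ for all }i\in[n]\right\}.$$ In particular, for a polytope $P\subseteq[0,1]^n\times\mathbb{R}^{n(n-1)/2}$ with $X(f)\subseteq\pi[f](P)$, we have $\pi[f](P)=X(f)$ if and only if for every $\boldsymbol{x}\in[0,1]^n$ there exist $X_1,\dots,X_n\in\mathcal{L}$ and $X'_1,\dots,X'_n\in\mathcal{L}$ with $\mu(X_i)=\mu(X'_i)=x_i$ for all $i\in[n]$, and $$\sum_{ij\in E}a_{ij}\,\mu(X_i\cap X_j)=\mathrm{LB}_P[f](\boldsymbol{x}),\qquad \sum_{ij\in E}a_{ij}\,\mu(X'_i\cap X'_j)=\mathrm{UB}_P[f](\boldsymbol{x}).$$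
   Context: $[n]=\{1,\dots,n\}$. $\mathcal{L}=\{[a_1,b_1)\cup\dots\cup[a_k,b_k): 0\le a_1<b_1<a_2<b_2<\dots<a_k<b_k\le 1,\ k\in\mathbb{N}\}$, where $k=0$ (the empty set) is allowed, and $\mu(X)=(b_1-a_1)+\dots+(b_k-a_k)$ (Lebesgue measure restricted to $\mathcal{L}$). $X(f)=\operatorname{conv}\{(\boldsymbol{x},z)\in[0,1]^n\times\mathbb{R}: z=f(\boldsymbol{x})\}$, which is a polytope. The convex and concave envelopes of $f$ on $[0,1]^n$ are $\operatorname{vex}[f](\boldsymbol{x})=\min\{z:(\boldsymbol{x},z)\in X(f)\}$ and $\operatorname{cav}[f](\boldsymbol{x})=\max\{z:(\boldsymbol{x},z)\in X(f)\}$. Points of $\mathbb{R}^{n}\times\mathbb{R}^{n(n-1)/2}$ are written $(\boldsymbol{x},\boldsymbol{y})$ with $\boldsymbol{y}=(y_{ij})_{1\le i<j\le n}$; $\pi[f](\boldsymbol{x},\boldsymbol{y})=(\boldsymbol{x},\sum_{ij\in E}a_{ij}y_{ij})$, and $\pi[f](P)$ is the image of $P$. Further, $\mathrm{LB}_P[f](\boldsymbol{x})=\min\{\sum_{ij\in E}a_{ij}y_{ij}:(\boldsymbol{x},\boldsymbol{y})\in P\}$ and $\mathrm{UB}_P[f](\boldsymbol{x})=\max\{\sum_{ij\in E}a_{ij}y_{ij}:(\boldsymbol{x},\boldsymbol{y})\in P\}$. *)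

theory Defs
  imports "HOL-Analysis.Analysis"
begin

text \<open>
  The index set \<open>[n]\<close> is the finite type \<open>'n\<close>. An edge \<open>ij\<close> is a two-element set \<open>e :: 'n set\<close>, so
  that \<open>x\<^sub>i x\<^sub>j\<close> is \<open>\<Prod>i\<in>e. x $ i\<close> and \<open>X\<^sub>i \<inter> X\<^sub>j\<close> is \<open>\<Inter>i\<in>e. X i\<close>.
\<close>

definition bilinear_fun :: "'n::finite set set \<Rightarrow> ('n set \<Rightarrow> real) \<Rightarrow> real ^ 'n \<Rightarrow> real" where
  "bilinear_fun E a x = (\<Sum>e\<in>E. a e * (\<Prod>i\<in>e. x $ i))"

definition graph_hull :: "(real ^ 'n \<Rightarrow> real) \<Rightarrow> ((real ^ 'n) \<times> real) set" where
  "graph_hull f = convex hull {(x, z). x \<in> cbox 0 1 \<and> z = f x}"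

definition is_minimum :: "real \<Rightarrow> real set \<Rightarrow> bool" where
  "is_minimum m S \<longleftrightarrow> m \<in> S \<and> (\<forall>s\<in>S. m \<le> s)"

definition is_maximum :: "real \<Rightarrow> real set \<Rightarrow> bool" where
  "is_maximum m S \<longleftrightarrow> m \<in> S \<and> (\<forall>s\<in>S. s \<le> m)"

text \<open>
  \<open>LEAST\<close> and \<open>GREATEST\<close> on the reals denote the attained minimum and maximum, if it
  exists. The lemmas below show that it does in all cases of interest.
\<close>

definition vex :: "(real ^ 'n \<Rightarrow> real) \<Rightarrow> real ^ 'n \<Rightarrow> real" where
  "vex f x = (LEAST z. (x, z) \<in> graph_hull f)"

definition cav :: "(real ^ 'n \<Rightarrow> real) \<Rightarrow> real ^ 'n \<Rightarrow> real" where
  "cav f x = (GREATEST z. (x, z) \<in> graph_hull f)"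

lemma is_minimum_LeastI:
  assumes "compact {z::real. Q z}" "{z. Q z} \<noteq> {}"
  shows "is_minimum (LEAST z. Q z) {z. Q z}"
proof -
  obtain m where m: "Q m" "\<And>z. Q z \<Longrightarrow> m \<le> z"
    using compact_attains_inf[OF assms] by auto
  then have "(LEAST z. Q z) = m" by (intro Least_equality) auto
  with m show ?thesis by (simp add: is_minimum_def)
qed

lemma is_maximum_GreatestI:
  assumes "compact {z::real. Q z}" "{z. Q z} \<noteq> {}"
  shows "is_maximum (GREATEST z. Q z) {z. Q z}"
proof -
  obtain m where m: "Q m" "\<And>z. Q z \<Longrightarrow> z \<le> m"
    using compact_attains_sup[OF assms] by auto
  then have "(GREATEST z. Q z) = m" by (intro Greatest_equality) auto
  with m show ?thesis by (simp add: is_maximum_def)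
qed

lemma compact_fibre:
  fixes S :: "('a::euclidean_space \<times> 'b::euclidean_space) set"
  assumes "compact S"
  shows "compact {z. (x, z) \<in> S}"
proof -
  have "{z. (x, z) \<in> S} = snd ` (S \<inter> ({x} \<times> UNIV))" by (auto intro: rev_image_eqI)
  moreover have "compact (S \<inter> ({x} \<times> UNIV))"
    by (rule compact_Int_closed[OF assms closed_Times]) simp_all
  ultimately show ?thesis
    using compact_continuous_image[OF continuous_on_snd[OF continuous_on_id]] by simp
qed

lemma compact_graph_hull:
  assumes "continuous_on (cbox 0 1) f"
  shows "compact (graph_hull f)"
proof -
  have "{(x, z). x \<in> cbox 0 1 \<and> z = f x} = (\<lambda>x. (x, f x)) ` cbox 0 1" by auto
  moreover have "compact ((\<lambda>x. (x, f x)) ` cbox 0 1)"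
    by (intro compact_continuous_image continuous_on_Pair continuous_on_id assms compact_cbox)
  ultimately show ?thesis
    unfolding graph_hull_def by (simp add: compact_convex_hull)
qed

lemma graph_hull_fibre_nonempty: "x \<in> cbox 0 1 \<Longrightarrow> {z. (x, z) \<in> graph_hull f} \<noteq> {}"
  using hull_inc[of "(x, f x)" "{(x, z). x \<in> cbox 0 1 \<and> z = f x}" convex]
  by (auto simp: graph_hull_def)

lemma vex_is_minimum:
  assumes "continuous_on (cbox 0 1) f" "x \<in> cbox 0 1"
  shows "is_minimum (vex f x) {z. (x, z) \<in> graph_hull f}"
  unfolding vex_def using assms
  by (intro is_minimum_LeastI compact_fibre compact_graph_hull graph_hull_fibre_nonempty)

lemma cav_is_maximum:
  assumes "continuous_on (cbox 0 1) f" "x \<in> cbox 0 1"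
  shows "is_maximum (cav f x) {z. (x, z) \<in> graph_hull f}"
  unfolding cav_def using assms
  by (intro is_maximum_GreatestI compact_fibre compact_graph_hull graph_hull_fibre_nonempty)

definition interval_unions :: "real set set" where
  "interval_unions = {X. \<exists>(k::nat) a b.
     (\<forall>i\<in>{1..k}. 0 \<le> a i \<and> a i < b i \<and> b i \<le> 1) \<and>
     (\<forall>i\<in>{1..<k}. b i < a (Suc i)) \<and>
     X = (\<Union>i\<in>{1..k}. {a i..<b i})}"

lemma measure_interval_union:
  fixes a b :: "nat \<Rightarrow> real"
  assumes lt: "\<forall>i\<in>{1..k}. a i < b i" and gap: "\<forall>i\<in>{1..<k}. b i < a (Suc i)"
  shows "measure lborel (\<Union>i\<in>{1..k}. {a i..<b i}) = (\<Sum>i\<in>{1..k}. b i - a i)"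
proof -
  have ord: "b i < a j" if "1 \<le> i" "i < j" "j \<le> k" for i j
    using that(2,3)
  proof (induction j)
    case (Suc j)
    show ?case
    proof (cases "i = j")
      case True
      then show ?thesis using gap Suc.prems that(1) by auto
    next
      case False
      then have "i < j" "j \<le> k" using Suc.prems by simp_all
      then have "b i < a j" by (rule Suc.IH)
      moreover have "a j < b j"
        by (rule bspec[OF lt]) (use \<open>i < j\<close> \<open>j \<le> k\<close> in simp)
      moreover have "b j < a (Suc j)"
        by (rule bspec[OF gap]) (use \<open>i < j\<close> Suc.prems in simp)
      ultimately show ?thesis by simp
    qed
  qed simp
  have "disjoint_family_on (\<lambda>i. {a i..<b i}) {1..k}"
    unfolding disjoint_family_on_def
  proof (intro ballI impI)
    fix i j assume "i \<in> {1..k}" "j \<in> {1..k}" "i \<noteq> j"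
    then have "b i < a j \<or> b j < a i" using ord[of i j] ord[of j i] by (simp add: neq_iff) linarith
    then show "{a i..<b i} \<inter> {a j..<b j} = {}" by auto
  qed
  then have "measure lborel (\<Union>i\<in>{1..k}. {a i..<b i})
      = (\<Sum>i\<in>{1..k}. measure lborel {a i..<b i})"
    using lt by (intro measure_finite_Union) (auto simp: emeasure_lborel_Ico less_imp_le)
  also have "\<dots> = (\<Sum>i\<in>{1..k}. b i - a i)"
    using lt by (intro sum.cong refl) (simp add: measure_def emeasure_lborel_Ico less_imp_le)
  finally show ?thesis .
qed

definition set_families :: "real ^ 'n \<Rightarrow> ('n \<Rightarrow> real set) set" where
  "set_families x = {X. \<forall>i. X i \<in> interval_unions \<and> measure lborel (X i) = x $ i}"

definition intersection_sum ::
    "'n::finite set set \<Rightarrow> ('n set \<Rightarrow> real) \<Rightarrow> ('n \<Rightarrow> real set) \<Rightarrow> real" where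
  "intersection_sum E a X = (\<Sum>e\<in>E. a e * measure lborel (\<Inter>i\<in>e. X i))"

text \<open>
  The space of vectors \<open>(y\<^sub>i\<^sub>j)\<close> with \<open>i < j\<close>, of dimension \<open>n(n-1)/2\<close>, is realised as the
  coordinate subspace of \<open>real ^ ('n set)\<close> spanned by the two-element index sets. A separate index
  type for the pairs would have to be empty for \<open>n = 1\<close>.
\<close>

definition pair_space :: "(real ^ ('n::finite set)) set" where
  "pair_space = {y. \<forall>e. card e \<noteq> 2 \<longrightarrow> y $ e = 0}"

definition pair_sum :: "'n::finite set set \<Rightarrow> ('n set \<Rightarrow> real) \<Rightarrow> real ^ ('n set) \<Rightarrow> real" where
  "pair_sum E a y = (\<Sum>e\<in>E. a e * y $ e)"

definition edge_proj ::
    "'n::finite set set \<Rightarrow> ('n set \<Rightarrow> real) \<Rightarrow> (real ^ 'n) \<times> (real ^ ('n set)) \<Rightarrow> (real ^ 'n) \<times> real" where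
  "edge_proj E a = (\<lambda>(x, y). (x, pair_sum E a y))"

definition LB ::
    "'n::finite set set \<Rightarrow> ('n set \<Rightarrow> real) \<Rightarrow> ((real ^ 'n) \<times> (real ^ ('n set))) set \<Rightarrow> real ^ 'n \<Rightarrow> real" where
  "LB E a P x = (LEAST z. \<exists>y. (x, y) \<in> P \<and> z = pair_sum E a y)"

definition UB ::
    "'n::finite set set \<Rightarrow> ('n set \<Rightarrow> real) \<Rightarrow> ((real ^ 'n) \<times> (real ^ ('n set))) set \<Rightarrow> real ^ 'n \<Rightarrow> real" where
  "UB E a P x = (GREATEST z. \<exists>y. (x, y) \<in> P \<and> z = pair_sum E a y)"

lemma LB_UB_attained:
  assumes "compact P" "(x, y) \<in> P"
  shows "is_minimum (LB E a P x) {z. \<exists>y. (x, y) \<in> P \<and> z = pair_sum E a y}"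
    and "is_maximum (UB E a P x) {z. \<exists>y. (x, y) \<in> P \<and> z = pair_sum E a y}"
proof -
  have "{z. \<exists>y. (x, y) \<in> P \<and> z = pair_sum E a y} = pair_sum E a ` {y. (x, y) \<in> P}" by auto
  moreover have "continuous_on {y. (x, y) \<in> P} (pair_sum E a)"
    unfolding pair_sum_def by (intro continuous_intros)
  ultimately have c: "compact {z. \<exists>y. (x, y) \<in> P \<and> z = pair_sum E a y}"
    using compact_continuous_image[OF _ compact_fibre[OF assms(1)], of x "pair_sum E a"] by simp
  have n: "{z. \<exists>y. (x, y) \<in> P \<and> z = pair_sum E a y} \<noteq> {}" using assms(2) by auto
  show "is_minimum (LB E a P x) {z. \<exists>y. (x, y) \<in> P \<and> z = pair_sum E a y}"
    unfolding LB_def by (rule is_minimum_LeastI[OF c n])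
  show "is_maximum (UB E a P x) {z. \<exists>y. (x, y) \<in> P \<and> z = pair_sum E a y}"
    unfolding UB_def by (rule is_maximum_GreatestI[OF c n])
qed

end

theory Submission imports Defs begin

text \<open>
  Every point of \<open>graph_hull f\<close> is a convex combination, with weights \<open>w A\<close>, of the points of the
  graph over the cube vertices \<open>\<chi> i. of_bool (i \<in> A)\<close>; the point \<open>x\<close> itself arises from the product
  weights \<open>(\<Prod>i\<in>A. x $ i) * (\<Prod>i\<in>-A. 1 - x $ i)\<close>. Such weights are the same data as a family of sets
  \<open>X i \<subseteq> [0, 1)\<close>: \<open>w A\<close> is the measure of the set of \<open>t\<close> that lie in precisely the \<open>X i\<close> with \<open>i \<in> A\<close>, and
  conversely one cuts \<open>[0, 1)\<close> into consecutive intervals of lengths \<open>w A\<close>. Hence the fibre of \<open>graph_hull f\<close>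
  over \<open>x\<close> consists of the values of \<open>intersection_sum\<close>.
\<close>

section \<open>The hull of the graph as combinations over cube vertices\<close>

text \<open>At the vertex belonging to \<open>A\<close> the monomial of \<open>e\<close> is 1 if
  \<open>e \<subseteq> A\<close> and 0 otherwise, so \<open>\<Sum>A | e \<subseteq> A. w A\<close>
  is the average of that monomial under the weights \<open>w\<close>.\<close>

definition vertex_combinations ::
    "'n::finite set set \<Rightarrow> ('n set \<Rightarrow> real) \<Rightarrow> ((real ^ 'n) \<times> real) set" where
  "vertex_combinations E a = {(x, z). \<exists>w :: 'n set \<Rightarrow> real. (\<forall>A. 0 \<le> w A) \<and> (\<Sum>A\<in>UNIV. w A) = 1 \<and>
     (\<forall>i. x $ i = (\<Sum>A | i \<in> A. w A)) \<and> z = (\<Sum>e\<in>E. a e * (\<Sum>A | e \<subseteq> A. w A))}"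

lemma convex_vertex_combinations: "convex (vertex_combinations E a)"
proof (rule convexI)
  fix p q :: "(real ^ 'a) \<times> real" and u v :: real
  assume p: "p \<in> vertex_combinations E a" and q: "q \<in> vertex_combinations E a"
    and uv: "0 \<le> u" "0 \<le> v" "u + v = 1"
  obtain w where w: "\<forall>A. 0 \<le> w A" "(\<Sum>A\<in>UNIV. w A) = 1" "\<forall>i. fst p $ i = (\<Sum>A | i \<in> A. w A)"
      "snd p = (\<Sum>e\<in>E. a e * (\<Sum>A | e \<subseteq> A. w A))"
    using p by (force simp: vertex_combinations_def)
  obtain w' where w': "\<forall>A. 0 \<le> w' A" "(\<Sum>A\<in>UNIV. w' A) = 1" "\<forall>i. fst q $ i = (\<Sum>A | i \<in> A. w' A)"
      "snd q = (\<Sum>e\<in>E. a e * (\<Sum>A | e \<subseteq> A. w' A))"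
    using q by (force simp: vertex_combinations_def)
  have "(fst (u *\<^sub>R p + v *\<^sub>R q), snd (u *\<^sub>R p + v *\<^sub>R q)) \<in> vertex_combinations E a"
    unfolding vertex_combinations_def mem_Collect_eq case_prod_conv
    by (rule exI[of _ "\<lambda>A. u * w A + v * w' A"])
      (use w w' uv in \<open>simp add: sum.distrib sum_distrib_left[symmetric] distrib_left mult.left_commute\<close>)
  then show "u *\<^sub>R p + v *\<^sub>R q \<in> vertex_combinations E a" by (simp only: prod.collapse)
qed

text \<open>For \<open>x\<close> in the cube: if a random set \<open>A\<close> contains each
  \<open>i\<close> independently with probability \<open>x i\<close>, both sides are the probability
  of \<open>e \<subseteq> A\<close>. The algebraic proof expands a product of sums and holds for all
  real \<open>x\<close>.\<close>

lemma sum_product_weights: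
  fixes x :: "'n::finite \<Rightarrow> real" and e :: "'n set"
  shows "(\<Sum>A | e \<subseteq> A. (\<Prod>i\<in>A. x i) * (\<Prod>i\<in>-A. 1 - x i)) = (\<Prod>i\<in>e. x i)"
proof -
  \<comment> \<open>With this \<open>g\<close>, the factor \<open>x i + g i\<close> is
    \<open>x i\<close> on \<open>e\<close> and 1 elsewhere, and every \<open>A\<close> that misses a
    point of \<open>e\<close> contributes a zero factor to the expansion.\<close>
  define g where "g i = (if i \<in> e then 0 else 1 - x i)" for i
  have "(\<Prod>i\<in>e. x i) = (\<Prod>i\<in>UNIV. if i \<in> e then x i else 1)"
    by (simp add: prod.If_cases)
  also have "\<dots> = (\<Prod>i\<in>UNIV. x i + g i)"
    by (intro prod.cong) (auto simp: g_def)
  also have "\<dots> = (\<Sum>A\<in>UNIV. (\<Prod>i\<in>A. x i) * (\<Prod>i\<in>-A. g i))"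
    by (simp add: prod_add Compl_eq_Diff_UNIV)
  also have "\<dots> = (\<Sum>A | e \<subseteq> A. (\<Prod>i\<in>A. x i) * (\<Prod>i\<in>-A. g i))"
    by (rule sum.mono_neutral_right) (auto simp: g_def)
  also have "\<dots> = (\<Sum>A | e \<subseteq> A. (\<Prod>i\<in>A. x i) * (\<Prod>i\<in>-A. 1 - x i))"
    by (intro sum.cong refl arg_cong2[where f = "(*)"] prod.cong) (auto simp: g_def)
  finally show ?thesis ..
qed

lemma graph_point_in_vertex_combinations:
  assumes "x \<in> cbox 0 1"
  shows "(x, bilinear_fun E a x) \<in> vertex_combinations E a"
  unfolding vertex_combinations_def mem_Collect_eq case_prod_conv
proof (intro exI[of _ "\<lambda>A. (\<Prod>i\<in>A. x $ i) * (\<Prod>i\<in>-A. 1 - x $ i)"] conjI allI)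
  show "0 \<le> (\<Prod>i\<in>A. x $ i) * (\<Prod>i\<in>-A. 1 - x $ i)" for A
    using assms by (auto simp: mem_box_cart intro!: mult_nonneg_nonneg prod_nonneg)
  show "(\<Sum>A\<in>UNIV. (\<Prod>i\<in>A. x $ i) * (\<Prod>i\<in>-A. 1 - x $ i)) = 1"
    using sum_product_weights[of "($) x" "{}"] by simp
  show "x $ i = (\<Sum>A | i \<in> A. (\<Prod>i\<in>A. x $ i) * (\<Prod>i\<in>-A. 1 - x $ i))" for i
    using sum_product_weights[of "($) x" "{i}"] by simp
qed (simp add: bilinear_fun_def sum_product_weights)

text \<open>One inclusion is minimality of the hull, as the right-hand side is convex and contains
  the graph. For the other, the weights \<open>w\<close> combine the graph points over the vertices
  \<open>v A\<close> into the given point.\<close>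

lemma graph_hull_bilinear: "graph_hull (bilinear_fun E a) = vertex_combinations E a"
proof
  show "graph_hull (bilinear_fun E a) \<subseteq> vertex_combinations E a"
    unfolding graph_hull_def
    by (rule hull_minimal) (auto simp: convex_vertex_combinations graph_point_in_vertex_combinations)
next
  show "vertex_combinations E a \<subseteq> graph_hull (bilinear_fun E a)"
  proof safe
    fix x :: "real ^ 'a" and z
    assume "(x, z) \<in> vertex_combinations E a"
    then obtain w where w: "\<forall>A. 0 \<le> w A" "(\<Sum>A\<in>UNIV. w A) = 1" "\<forall>i. x $ i = (\<Sum>A | i \<in> A. w A)"
        "z = (\<Sum>e\<in>E. a e * (\<Sum>A | e \<subseteq> A. w A))"
      by (force simp: vertex_combinations_def)
    define v :: "'a set \<Rightarrow> real ^ 'a" where "v A = (\<chi> i. of_bool (i \<in> A))" for A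
    have fv: "bilinear_fun E a (v A) = (\<Sum>e\<in>E. a e * of_bool (e \<subseteq> A))" for A
    proof -
      have "(\<Prod>i\<in>e. v A $ i) = of_bool (e \<subseteq> A)" for e
        by (cases "e \<subseteq> A") (auto simp: v_def intro!: prod.neutral)
      then show ?thesis by (simp add: bilinear_fun_def)
    qed
    have wQ: "(\<Sum>A\<in>UNIV. w A * of_bool (Q A)) = (\<Sum>A | Q A. w A)" for Q
      by simp
    have "(v A, bilinear_fun E a (v A)) \<in> graph_hull (bilinear_fun E a)" for A
      unfolding graph_hull_def by (rule hull_inc) (simp add: v_def mem_box_cart)
    then have "(\<Sum>A\<in>UNIV. w A *\<^sub>R (v A, bilinear_fun E a (v A))) \<in> graph_hull (bilinear_fun E a)"
      using w by (intro convex_sum) (auto simp: graph_hull_def)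
    also have "(\<Sum>A\<in>UNIV. w A *\<^sub>R (v A, bilinear_fun E a (v A))) = (x, z)"
    proof (rule prod_eqI)
      show "fst (\<Sum>A\<in>UNIV. w A *\<^sub>R (v A, bilinear_fun E a (v A))) = fst (x, z)"
        by (simp add: fst_sum vec_eq_iff v_def w(3))
      have "(\<Sum>A\<in>UNIV. w A * bilinear_fun E a (v A)) = (\<Sum>A\<in>UNIV. \<Sum>e\<in>E. a e * (w A * of_bool (e \<subseteq> A)))"
        unfolding fv sum_distrib_left by (simp only: mult.left_commute)
      also have "\<dots> = (\<Sum>e\<in>E. a e * (\<Sum>A\<in>UNIV. w A * of_bool (e \<subseteq> A)))"
        unfolding sum_distrib_left by (rule sum.swap)
      also have "\<dots> = z"
        unfolding w(4) wQ ..
      finally show "snd (\<Sum>A\<in>UNIV. w A *\<^sub>R (v A, bilinear_fun E a (v A))) = snd (x, z)"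
        by (simp add: snd_sum)
    qed
    finally show "(x, z) \<in> graph_hull (bilinear_fun E a)" .
  qed
qed

section \<open>Half-open interval unions built from consecutive intervals\<close>

lemma interval_unions_subset: "X \<in> interval_unions \<Longrightarrow> X \<subseteq> {0..<1}"
  by (fastforce simp: interval_unions_def)

lemma interval_unions_borel: "X \<in> interval_unions \<Longrightarrow> X \<in> sets borel"
  by (auto simp: interval_unions_def)

lemma empty_in_interval_unions: "{} \<in> interval_unions"
  unfolding interval_unions_def by (rule CollectI, rule exI[of _ 0]) auto

text \<open>The strict gaps required by \<open>interval_unions\<close> forbid touching pieces. If
  the last piece of \<open>X\<close> ends at \<open>c\<close>, it is prolonged to \<open>d\<close>;
  otherwise a nonempty \<open>{c..<d}\<close> becomes a new last piece.\<close>

lemma interval_unions_append: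
  assumes X: "X \<in> interval_unions" "X \<subseteq> {0..<c}" and cd: "0 \<le> c" "c \<le> d" "d \<le> 1"
  shows "X \<union> {c..<d} \<in> interval_unions"
proof (cases "c = d")
  case False
  with cd have "c < d" by simp
  obtain k :: nat and a b where
    ab: "\<forall>i\<in>{1..k}. 0 \<le> a i \<and> a i < b i \<and> b i \<le> 1" "\<forall>i\<in>{1..<k}. b i < a (Suc i)"
    and Xeq: "X = (\<Union>i\<in>{1..k}. {a i..<b i})"
    using X(1) by (auto simp: interval_unions_def)
  \<comment> \<open>The premise says that the last piece ends strictly before \<open>c\<close>; for
    \<open>k = 0\<close> it is vacuous.\<close>
  have append: ?thesis if "\<forall>i\<in>{1..<Suc k}. i = k \<longrightarrow> b i < c"
    unfolding interval_unions_def
    by (rule CollectI, rule exI[of _ "Suc k"], rule exI[of _ "a(Suc k := c)"], rule exI[of _ "b(Suc k := d)"])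
      (use ab that cd \<open>c < d\<close> in \<open>auto simp: Xeq atLeastAtMostSuc_conv\<close>)
  show ?thesis
  proof (cases k)
    case 0
    then show ?thesis using append by simp
  next
    case (Suc m)
    have "b k \<le> c"
    proof (rule ccontr)
      assume "\<not> b k \<le> c"
      moreover have "a k < b k" "k \<in> {1..k}" using ab(1) Suc by simp_all
      \<comment> \<open>This point lies in the last piece, yet not below \<open>c\<close>.\<close>
      ultimately have "max (a k) c \<in> X" unfolding Xeq by (intro UN_I[of k]) auto
      then show False using X(2) by auto
    qed
    show ?thesis
    proof (cases "b k = c")
      case True
      have "a k < b k" using ab(1) Suc by simp
      then have U: "{a k..<b k} \<union> {c..<d} = {a k..<d}" using True \<open>c < d\<close> by auto
      have "X \<union> {c..<d} = (\<Union>i\<in>{1..m}. {a i..<b i}) \<union> ({a k..<b k} \<union> {c..<d})"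
        by (auto simp: Xeq Suc atLeastAtMostSuc_conv)
      also have "\<dots> = (\<Union>i\<in>{1..k}. {a i..<(b(k := d)) i})"
        unfolding U by (auto simp: Suc atLeastAtMostSuc_conv)
      finally have eq: "X \<union> {c..<d} = \<dots>" .
      show ?thesis
        unfolding interval_unions_def
        by (rule CollectI, rule exI[of _ k], rule exI[of _ a], rule exI[of _ "b(k := d)"])
          (use ab eq \<open>a k < b k\<close> True \<open>c < d\<close> cd in auto)
    next
      case False
      then show ?thesis using append \<open>b k \<le> c\<close> by simp
    qed
  qed
qed (use X in simp)

lemma union_consecutive_intervals:
  fixes s :: "nat \<Rightarrow> real"
  assumes s: "s 0 = 0" "mono s" and N: "s N \<le> 1"
  shows "(\<Union>k\<in>{k. k < N \<and> Q k}. {s k..<s (Suc k)}) \<in> interval_unions"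
proof -
  \<comment> \<open>The bound by \<open>s m\<close> is carried through the induction because
    \<open>interval_unions_append\<close> asks for it.\<close>
  have "(\<Union>k\<in>{k. k < m \<and> Q k}. {s k..<s (Suc k)}) \<in> interval_unions \<and>
      (\<Union>k\<in>{k. k < m \<and> Q k}. {s k..<s (Suc k)}) \<subseteq> {0..<s m}" if "m \<le> N" for m
    using that
  proof (induction m)
    case (Suc m)
    let ?U = "\<lambda>m. \<Union>k\<in>{k. k < m \<and> Q k}. {s k..<s (Suc k)}"
    have IH: "?U m \<in> interval_unions" "?U m \<subseteq> {0..<s m}" using Suc by auto
    have le: "0 \<le> s m" "s m \<le> s (Suc m)" "s (Suc m) \<le> 1"
      using monoD[OF s(2), of 0 m] monoD[OF s(2), of m "Suc m"] monoD[OF s(2), of "Suc m" N] s N Suc.prems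
      by auto
    have "?U (Suc m) = (if Q m then ?U m \<union> {s m..<s (Suc m)} else ?U m)"
      by (auto simp: less_Suc_eq)
    moreover have "?U m \<union> {s m..<s (Suc m)} \<in> interval_unions"
      by (rule interval_unions_append[OF IH le])
    moreover have "?U m \<union> {s m..<s (Suc m)} \<subseteq> {0..<s (Suc m)}" "?U m \<subseteq> {0..<s (Suc m)}"
      using IH(2) le by (auto dest!: subsetD[OF IH(2)] simp del: UN_iff)
    ultimately show ?case using IH(1) by (cases "Q m") simp_all
  qed (simp add: empty_in_interval_unions)
  then show ?thesis by blast
qed

lemma consecutive_intervals_disjoint:
  fixes s :: "nat \<Rightarrow> real"
  assumes "mono s" "t \<in> {s k..<s (Suc k)}" "t \<in> {s l..<s (Suc l)}"
  shows "k = l"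
proof (rule ccontr)
  assume "k \<noteq> l"
  then have "s (Suc k) \<le> s l \<or> s (Suc l) \<le> s k"
    using assms(1) by (metis Suc_leI linorder_neqE_nat monoD)
  then show False using assms by auto
qed

lemma measure_consecutive_intervals:
  fixes s :: "nat \<Rightarrow> real"
  assumes "mono s"
  shows "measure lborel (\<Union>k\<in>{k. k < N \<and> Q k}. {s k..<s (Suc k)}) = (\<Sum>k | k < N \<and> Q k. s (Suc k) - s k)"
proof -
  have "disjoint_family_on (\<lambda>k. {s k..<s (Suc k)}) {k. k < N \<and> Q k}"
    using consecutive_intervals_disjoint[OF assms] unfolding disjoint_family_on_def by blast
  moreover have le: "s k \<le> s (Suc k)" for k using assms by (simp add: monoD)
  ultimately have "measure lborel (\<Union>k\<in>{k. k < N \<and> Q k}. {s k..<s (Suc k)})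
      = (\<Sum>k | k < N \<and> Q k. measure lborel {s k..<s (Suc k)})"
    by (intro measure_finite_Union) (auto simp: emeasure_lborel_Ico)
  then show ?thesis using le by (simp add: measure_def emeasure_lborel_Ico)
qed

section \<open>Translation between vertex weights and set families\<close>

lemma vertex_combination_imp_intersection_sum:
  assumes E: "\<forall>e\<in>E. card e = 2" and xz: "(x, z) \<in> vertex_combinations E a"
  shows "\<exists>X\<in>set_families x. intersection_sum E a X = z"
proof -
  obtain w :: "'a set \<Rightarrow> real" where w: "\<forall>A. 0 \<le> w A" "(\<Sum>A\<in>UNIV. w A) = 1"
      "\<forall>i. x $ i = (\<Sum>A | i \<in> A. w A)" "z = (\<Sum>e\<in>E. a e * (\<Sum>A | e \<subseteq> A. w A))"
    using xz by (force simp: vertex_combinations_def)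
  \<comment> \<open>An arbitrary enumeration of all subsets fixes the order of the intervals. The
    partial sums \<open>s\<close> give the \<open>k\<close>-th interval length
    \<open>w (h k)\<close>; a zero weight gives an empty interval.\<close>
  obtain h :: "nat \<Rightarrow> 'a set" and N where h: "bij_betw h {..<N} UNIV"
    using ex_bij_betw_nat_finite[OF finite[of "UNIV :: 'a set set"]] by (metis atLeast0LessThan)
  define s where "s k = (\<Sum>j<k. w (h j))" for k
  have mono: "mono s" by (rule incseq_SucI) (simp add: s_def w(1))
  have s0: "s 0 = 0" by (simp add: s_def)
  have sN: "s N \<le> 1" using sum.reindex_bij_betw[OF h, of w] w(2) by (simp add: s_def)
  define X where "X i = (\<Union>k\<in>{k. k < N \<and> i \<in> h k}. {s k..<s (Suc k)})" for i
  \<comment> \<open>For \<open>e = {}\<close> the intersection is the whole line, whose infinite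
    measure is turned into 0 by \<open>measure\<close>, whereas the weights sum to 1.\<close>
  have meas: "measure lborel (\<Inter>i\<in>e. X i) = (\<Sum>A | e \<subseteq> A. w A)" if ne: "e \<noteq> {}" for e
  proof -
    have "(\<Inter>i\<in>e. X i) = (\<Union>k\<in>{k. k < N \<and> e \<subseteq> h k}. {s k..<s (Suc k)})"
    proof
      show "(\<Inter>i\<in>e. X i) \<subseteq> (\<Union>k\<in>{k. k < N \<and> e \<subseteq> h k}. {s k..<s (Suc k)})"
      proof
        fix t assume t: "t \<in> (\<Inter>i\<in>e. X i)"
        obtain i where "i \<in> e" using ne by blast
        with t obtain k where k: "k < N" "t \<in> {s k..<s (Suc k)}" unfolding X_def by blast
        \<comment> \<open>The intervals are disjoint, so every \<open>X j\<close> containing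
          \<open>t\<close> contains it through the same index \<open>k\<close>.\<close>
        have "e \<subseteq> h k"
        proof
          fix j assume "j \<in> e"
          with t obtain l where l: "j \<in> h l" "t \<in> {s l..<s (Suc l)}" unfolding X_def by blast
          with consecutive_intervals_disjoint[OF mono k(2) l(2)] show "j \<in> h k" by simp
        qed
        with k show "t \<in> (\<Union>k\<in>{k. k < N \<and> e \<subseteq> h k}. {s k..<s (Suc k)})" by blast
      qed
    qed (auto simp: X_def)
    then have "measure lborel (\<Inter>i\<in>e. X i) = (\<Sum>k | k < N \<and> e \<subseteq> h k. w (h k))"
      by (simp add: measure_consecutive_intervals[OF mono]) (simp add: s_def)
    also have "\<dots> = (\<Sum>A | e \<subseteq> A. w A)"
    proof (rule sum.reindex_bij_betw)
      show "bij_betw h {k. k < N \<and> e \<subseteq> h k} {A. e \<subseteq> A}"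
      proof (rule bij_betw_subset[OF h])
        have "{A. e \<subseteq> A} \<subseteq> h ` {..<N}" using h by (simp add: bij_betw_def)
        then show "h ` {k. k < N \<and> e \<subseteq> h k} = {A. e \<subseteq> A}" by blast
      qed auto
    qed
    finally show ?thesis .
  qed
  have "X \<in> set_families x"
    unfolding set_families_def
  proof (intro CollectI allI conjI)
    show "X i \<in> interval_unions" for i
      unfolding X_def by (rule union_consecutive_intervals[OF s0 mono sN])
    show "measure lborel (X i) = x $ i" for i using meas[of "{i}"] w(3) by simp
  qed
  moreover have "intersection_sum E a X = z"
    unfolding intersection_sum_def w(4)
    by (intro sum.cong refl) (use E in \<open>subst meas; force\<close>)
  ultimately show ?thesis by blast
qed

lemma intersection_sum_imp_vertex_combination:
  assumes E: "\<forall>e\<in>E. card e = 2" and X: "X \<in> set_families x"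
  shows "(x, intersection_sum E a X) \<in> vertex_combinations E a"
proof -
  have XL: "X i \<in> interval_unions" and Xm: "measure lborel (X i) = x $ i" for i
    using X by (auto simp: set_families_def)
  have [measurable]: "X i \<in> sets borel" for i by (rule interval_unions_borel[OF XL])
  \<comment> \<open>These are the atoms of the family. The restriction to \<open>{0..<1}\<close>
    keeps \<open>T {}\<close> of finite measure, so that the atoms partition a set of measure
    1.\<close>
  define T where "T A = {t \<in> {0..<1}. \<forall>i. t \<in> X i \<longleftrightarrow> i \<in> A}" for A
  have T_sets[measurable]: "T A \<in> sets borel" for A unfolding T_def by measurable
  have T_fin: "emeasure lborel (T A) \<noteq> \<infinity>" for A
  proof -
    have "emeasure lborel (T A) \<le> emeasure lborel {0..<1::real}"
      by (rule emeasure_mono) (auto simp: T_def)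
    then show ?thesis by (auto simp: top_unique)
  qed
  have meas: "(\<Sum>A | Q A. measure lborel (T A)) = measure lborel (\<Union>A\<in>{A. Q A}. T A)" for Q
  proof (rule measure_finite_Union[symmetric])
    show "disjoint_family_on T {A. Q A}" by (auto simp: disjoint_family_on_def T_def)
    show "T ` {A. Q A} \<subseteq> sets lborel" using T_sets by (simp add: image_subset_iff)
  qed (rule finite, rule T_fin)
  have Inter: "(\<Sum>A | e \<subseteq> A. measure lborel (T A)) = measure lborel (\<Inter>i\<in>e. X i)" if "e \<noteq> {}" for e
  proof -
    have "(\<Union>A\<in>{A. e \<subseteq> A}. T A) = (\<Inter>i\<in>e. X i)"
    proof
      show "(\<Inter>i\<in>e. X i) \<subseteq> (\<Union>A\<in>{A. e \<subseteq> A}. T A)"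
      proof
        fix t assume t: "t \<in> (\<Inter>i\<in>e. X i)"
        \<comment> \<open>Since \<open>e\<close> is nonempty, \<open>t\<close> lies in some
          \<open>X i\<close>, and that set is contained in \<open>{0..<1}\<close>.\<close>
        then have "t \<in> {0..<1}" using that interval_unions_subset[OF XL] by blast
        then have "t \<in> T {i. t \<in> X i}" by (simp add: T_def)
        moreover have "{i. t \<in> X i} \<in> {A. e \<subseteq> A}" using t by auto
        ultimately show "t \<in> (\<Union>A\<in>{A. e \<subseteq> A}. T A)" by (rule UN_I[rotated])
      qed
    qed (auto simp: T_def)
    then show ?thesis by (simp add: meas)
  qed
  show ?thesis
    unfolding vertex_combinations_def mem_Collect_eq case_prod_conv
  proof (intro exI[of _ "\<lambda>A. measure lborel (T A)"] conjI allI)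
    have "t \<in> T {i. t \<in> X i}" if "t \<in> {0..<1}" for t using that by (simp add: T_def)
    then have "(\<Union>A. T A) = {0..<1}" unfolding T_def by blast
    then show "(\<Sum>A\<in>UNIV. measure lborel (T A)) = 1"
      using meas[of "\<lambda>_. True"] by (simp add: measure_def emeasure_lborel_Ico)
    show "x $ i = (\<Sum>A | i \<in> A. measure lborel (T A))" for i
      using Inter[of "{i}"] Xm by simp
    show "intersection_sum E a X = (\<Sum>e\<in>E. a e * (\<Sum>A | e \<subseteq> A. measure lborel (T A)))"
      unfolding intersection_sum_def by (intro sum.cong refl) (use E in \<open>subst Inter; force\<close>)
  qed simp
qed

section \<open>Fibres of the hull and the extremal statements\<close>

text \<open>As an equality of sets, this carries the attained extrema \<open>vex\<close> and
  \<open>cav\<close> of the fibre directly over to the intersection sums.\<close>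

lemma graph_hull_fibre:
  assumes "\<forall>e\<in>E. card e = 2"
  shows "{intersection_sum E a X | X. X \<in> set_families x} = {z. (x, z) \<in> graph_hull (bilinear_fun E a)}"
  unfolding graph_hull_bilinear
  using vertex_combination_imp_intersection_sum[OF assms] intersection_sum_imp_vertex_combination[OF assms]
  by blast

lemma edge_proj_fibre: "{z. (x, z) \<in> edge_proj E a ` P} = {z. \<exists>y. (x, y) \<in> P \<and> z = pair_sum E a y}"
  by (force simp: edge_proj_def)

theorem corollary1:
  fixes E :: "'n::finite set set" and a :: "'n set \<Rightarrow> real"
  assumes "\<forall>e\<in>E. card e = 2"
    and "\<forall>e\<in>E. a e \<noteq> 0"
  shows "(\<forall>x\<in>cbox 0 1.
            is_minimum (vex (bilinear_fun E a) x) {intersection_sum E a X | X. X \<in> set_families x}) \<and>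
         (\<forall>x\<in>cbox 0 1.
            is_maximum (cav (bilinear_fun E a) x) {intersection_sum E a X | X. X \<in> set_families x}) \<and>
         (\<forall>P. polytope P \<and> P \<subseteq> cbox 0 1 \<times> pair_space \<and>
            graph_hull (bilinear_fun E a) \<subseteq> edge_proj E a ` P \<longrightarrow>
            (edge_proj E a ` P = graph_hull (bilinear_fun E a) \<longleftrightarrow>
             (\<forall>x\<in>cbox 0 1. \<exists>X\<in>set_families x. \<exists>X'\<in>set_families x.
                intersection_sum E a X = LB E a P x \<and> intersection_sum E a X' = UB E a P x)))"
proof (intro conjI allI impI ballI)
  let ?f = "bilinear_fun E a"
  have cont: "continuous_on (cbox 0 1) ?f"
    unfolding bilinear_fun_def by (intro continuous_intros)
  show "is_minimum (vex ?f x) {intersection_sum E a X | X. X \<in> set_families x}" if "x \<in> cbox 0 1" for x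
    unfolding graph_hull_fibre[OF assms(1)] by (rule vex_is_minimum[OF cont that])
  show "is_maximum (cav ?f x) {intersection_sum E a X | X. X \<in> set_families x}" if "x \<in> cbox 0 1" for x
    unfolding graph_hull_fibre[OF assms(1)] by (rule cav_is_maximum[OF cont that])
  fix P :: "((real ^ 'n) \<times> (real ^ ('n set))) set"
  assume P: "polytope P \<and> P \<subseteq> cbox 0 1 \<times> pair_space \<and> graph_hull ?f \<subseteq> edge_proj E a ` P"
  have "compact P" using P polytope_imp_compact by blast
  \<comment> \<open>The inclusion of the hull in the projection makes the fibre of \<open>P\<close>
    over \<open>x\<close> nonempty; with compactness, \<open>LB\<close> and \<open>UB\<close> are
    then genuine extrema rather than unspecified values.\<close>
  have attained: "is_minimum (LB E a P x) {z. (x, z) \<in> edge_proj E a ` P}"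
      "is_maximum (UB E a P x) {z. (x, z) \<in> edge_proj E a ` P}" if x: "x \<in> cbox 0 1" for x
  proof -
    obtain z where "(x, z) \<in> edge_proj E a ` P" using graph_hull_fibre_nonempty[OF x, of ?f] P by blast
    then obtain y where "(x, y) \<in> P" by (auto simp: edge_proj_def)
    then show "is_minimum (LB E a P x) {z. (x, z) \<in> edge_proj E a ` P}"
        "is_maximum (UB E a P x) {z. (x, z) \<in> edge_proj E a ` P}"
      unfolding edge_proj_fibre by (rule LB_UB_attained[OF \<open>compact P\<close>])+
  qed
  have realised: "(\<exists>X\<in>set_families x. intersection_sum E a X = z) \<longleftrightarrow> (x, z) \<in> graph_hull ?f" for x z
    using graph_hull_fibre[OF assms(1), of a x] unfolding set_eq_iff mem_Collect_eq by metis
  \<comment> \<open>Equality only has to be tested at the two ends of each vertical fibre: the fibre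
    of the projection lies between \<open>LB\<close> and \<open>UB\<close>, and the convex hull
    contains the segment joining those ends once it contains both.\<close>
  have "edge_proj E a ` P = graph_hull ?f \<longleftrightarrow>
      (\<forall>x\<in>cbox 0 1. (x, LB E a P x) \<in> graph_hull ?f \<and> (x, UB E a P x) \<in> graph_hull ?f)"
  proof (intro iffI ballI)
    fix x :: "real ^ 'n" assume "edge_proj E a ` P = graph_hull ?f" "x \<in> cbox 0 1"
    then show "(x, LB E a P x) \<in> graph_hull ?f \<and> (x, UB E a P x) \<in> graph_hull ?f"
      using attained[of x] by (simp add: is_minimum_def is_maximum_def)
  next
    assume *: "\<forall>x\<in>cbox 0 1. (x, LB E a P x) \<in> graph_hull ?f \<and> (x, UB E a P x) \<in> graph_hull ?f"
    have "p \<in> graph_hull ?f" if p: "p \<in> edge_proj E a ` P" for p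
    proof -
      obtain x z where xz: "p = (x, z)" by fastforce
      have x: "x \<in> cbox 0 1" using p P by (auto simp: edge_proj_def xz)
      have "LB E a P x \<le> z" "z \<le> UB E a P x"
        using attained[OF x] p xz by (auto simp: is_minimum_def is_maximum_def)
      then have "z \<in> closed_segment (LB E a P x) (UB E a P x)"
        by (auto simp: closed_segment_eq_real_ivl)
      then have "(x, z) \<in> closed_segment (x, LB E a P x) (x, UB E a P x)"
        by (auto simp: closed_segment_def algebra_simps scaleR_add_left[symmetric])
      moreover have "convex (graph_hull ?f)" by (simp add: graph_hull_def)
      ultimately show ?thesis using * x unfolding xz convex_contains_segment by blast
    qed
    then show "edge_proj E a ` P = graph_hull ?f" using P by blast
  qed
  then show "edge_proj E a ` P = graph_hull ?f \<longleftrightarrow>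
      (\<forall>x\<in>cbox 0 1. \<exists>X\<in>set_families x. \<exists>X'\<in>set_families x.
        intersection_sum E a X = LB E a P x \<and> intersection_sum E a X' = UB E a P x)"
    unfolding realised[symmetric] by blast
qed

end
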